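(* Let $D,n\ge 3$ be integers, let $x$ be a vertex of the Hamming graph $H(D,n)$, let $\Gamma=H(D,n)_f(x)$ be the full bipartite graph of $H(D,n)$ with respect to $x$, and let $A$ be the adjacency matrix of $\Gamma$. Then $A$ is $Q$-polynomial with respect to $x$.
   Context: Hamming graph: let $S$ be a set with $n$ elements. $H(D,n)$ has vertex set $X=S^D$, and two vertices are adjacent iff they differ in precisely one coordinate. Let $\partial$ denote path-length distance in $H(D,n)$ (the Hamming distance). Full bipartite graph: given a connected graph with vertex set $X$, edge set $\mathcal{E}$, distance $\partial$, and a vertex $x$, its full bipartite graph with respect to $x$ is the graph $(X,\mathcal{E}_f)$ with $\mathcal{E}_f=\mathcal{E}\setminus\{yz \mid \partial(x,y)=\partial(x,z)\}$. (Distances from $x$ are the same in both graphs.) Matrices: $\mathrm{Mat}_X(\mathbb{R})$ is the algebra of real matrices with rows and columns indexed by $X$, acting on the space $V=\mathbb{R}^X$ of column vectors. Subalgebras generated by a matrix contain the identity matrix $I$. $A\in \mathrm{Mat}_X(\mathbb{R})$ is the usual $0/1$ adjacency matrix of $\Gamma$. Dual adjacency algebra: for $0\le i\le D$ let $E_i^*\in \mathrm{Mat}_X(\mathbb{R})$ be the diagonal matrix whose $(y,y)$-entry is $1$ if $\partial(x,y)=i$ and $0$ otherwise. The dual adjacency algebra $M^*$ of $\Gamma$ with respect to $x$ is the span of $E_0^*,\dots,E_D^*$. Primitive idempotents: let $M$ be the subalgebra generated by the (diagonalizable) matrix $A$, of dimension $\mathcal{D}+1$. Then $M$ has a basis $\{E_i\}_{i=0}^{\mathcal{D}}$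 with $\sum_i E_i=I$ and $E_iE_j=\delta_{ij}E_i$; these are the primitive idempotents of $A$, i.e. the projections of $V$ onto the eigenspaces of $A$. $Q$-polynomial property: given an ordering $\{E_i\}_{i=0}^{\mathcal{D}}$ of the primitive idempotents (with $E_{-1}=E_{\mathcal{D}+1}=0$), a matrix $A^*\in \mathrm{Mat}_X(\mathbb{R})$ is a dual adjacency matrix of $\Gamma$ with respect to $x$ and this ordering if $A^*$ generates $M^*$ and $A^*E_iV\subseteq E_{i-1}V+E_iV+E_{i+1}V$ for $0\le i\le \mathcal{D}$. The ordering is $Q$-polynomial with respect to $x$ if such a dual adjacency matrix exists. The matrix $A$ is $Q$-polynomial with respect to $x$ if some ordering of its primitive idempotents is $Q$-polynomial with respect to $x$. *)

theory Defs
  imports "HOL-Analysis.Analysis"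
begin

text \<open>A graph whose vertices are all elements of a finite type \<open>'v\<close> is represented by its
  symmetric, irreflexive set of ordered pairs of adjacent vertices. Thus \<open>G ^^ k\<close> relates the
  end points of walks of length \<open>k\<close>, and matrices in \<open>Mat\<^sub>X(\<real>)\<close> have type
  \<open>real ^ 'v ^ 'v\<close>.\<close>

text \<open>Only meaningful for vertices in the same connected component.\<close>

definition graph_dist :: "('v \<times> 'v) set \<Rightarrow> 'v \<Rightarrow> 'v \<Rightarrow> nat" where
  "graph_dist G y z = (LEAST k. (y, z) \<in> G ^^ k)"

definition eccentricity :: "('v::finite \<times> 'v) set \<Rightarrow> 'v \<Rightarrow> nat" where
  "eccentricity G x = Max (range (graph_dist G x))"

text \<open>The set \<open>S\<close> with \<open>n\<close> elements is the type \<open>'s\<close> and \<open>D = CARD('d)\<close>, so that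
  \<open>S\<^sup>D\<close> is the type \<open>'s ^ 'd\<close>.\<close>

definition hamming_graph :: "(('s ^ 'd) \<times> ('s ^ 'd)) set" where
  "hamming_graph = {(y, z). card {i. y $ i \<noteq> z $ i} = 1}"

definition full_bipartite_graph :: "('v \<times> 'v) set \<Rightarrow> 'v \<Rightarrow> ('v \<times> 'v) set" where
  "full_bipartite_graph G x = G - {(y, z). graph_dist G x y = graph_dist G x z}"

definition adjacency_matrix :: "('v::finite \<times> 'v) set \<Rightarrow> real ^ 'v ^ 'v" where
  "adjacency_matrix G = (\<chi> y z. if (y, z) \<in> G then 1 else 0)"

definition dual_idempotent :: "('v::finite \<times> 'v) set \<Rightarrow> 'v \<Rightarrow> nat \<Rightarrow> real ^ 'v ^ 'v" where
  "dual_idempotent G x i = (\<chi> y z. if y = z \<and> graph_dist G x y = i then 1 else 0)"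

text \<open>The last index is the largest distance from \<open>x\<close>; it is \<open>D\<close> for \<open>H(D,n)\<close> with
  \<open>n \<ge> 2\<close> and for its full bipartite graph.\<close>

definition dual_adjacency_algebra :: "('v::finite \<times> 'v) set \<Rightarrow> 'v \<Rightarrow> (real ^ 'v ^ 'v) set" where
  "dual_adjacency_algebra G x = span (dual_idempotent G x ` {0..eccentricity G x})"

definition matrix_subalgebra :: "(real ^ 'v ^ 'v) set \<Rightarrow> bool" where
  "matrix_subalgebra M \<longleftrightarrow> subspace M \<and> mat 1 \<in> M \<and> (\<forall>B\<in>M. \<forall>C\<in>M. B ** C \<in> M)"

definition generated_subalgebra :: "real ^ 'v ^ 'v \<Rightarrow> (real ^ 'v ^ 'v) set" where
  "generated_subalgebra B = matrix_subalgebra hull {B}"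

text \<open>\<open>E\<^sub>0, \<dots>, E\<^sub>d\<close> is an ordering of the primitive idempotents of \<open>A\<close>. Integer
  indices are used to accommodate the convention \<open>E\<^sub>-\<^sub>1 = E\<^sub>d\<^sub>+\<^sub>1 = 0\<close>. The number
  \<open>d\<close> is determined by \<open>A\<close>: the algebra generated by \<open>A\<close> has dimension \<open>d + 1\<close>.\<close>

definition primitive_idempotent_ordering ::
  "real ^ 'v ^ 'v \<Rightarrow> nat \<Rightarrow> (int \<Rightarrow> real ^ 'v ^ 'v) \<Rightarrow> bool" where
  "primitive_idempotent_ordering A d E \<longleftrightarrow>
     inj_on E {0..int d} \<and> independent (E ` {0..int d}) \<and>
     span (E ` {0..int d}) = generated_subalgebra A \<and>
     (\<Sum>i\<in>{0..int d}. E i) = mat 1 \<and>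
     (\<forall>i\<in>{0..int d}. \<forall>j\<in>{0..int d}. E i ** E j = (if i = j then E i else 0)) \<and>
     E (- 1) = 0 \<and> E (int d + 1) = 0"

definition matrix_image :: "real ^ 'v ^ 'v \<Rightarrow> (real ^ 'v) set" where
  "matrix_image B = range (\<lambda>v. B *v v)"

definition dual_adjacency_matrix ::
  "('v::finite \<times> 'v) set \<Rightarrow> 'v \<Rightarrow> nat \<Rightarrow> (int \<Rightarrow> real ^ 'v ^ 'v) \<Rightarrow> real ^ 'v ^ 'v \<Rightarrow> bool" where
  "dual_adjacency_matrix G x d E B \<longleftrightarrow>
     generated_subalgebra B = dual_adjacency_algebra G x \<and>
     (\<forall>i\<in>{0..int d}. (\<lambda>v. B *v v) ` matrix_image (E i) \<subseteq>
        {u + v + w | u v w. u \<in> matrix_image (E (i - 1)) \<and> v \<in> matrix_image (E i) \<and>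
                            w \<in> matrix_image (E (i + 1))})"

definition Q_polynomial_ordering ::
  "('v::finite \<times> 'v) set \<Rightarrow> 'v \<Rightarrow> nat \<Rightarrow> (int \<Rightarrow> real ^ 'v ^ 'v) \<Rightarrow> bool" where
  "Q_polynomial_ordering G x d E \<longleftrightarrow> (\<exists>B. dual_adjacency_matrix G x d E B)"

definition Q_polynomial :: "('v::finite \<times> 'v) set \<Rightarrow> 'v \<Rightarrow> real ^ 'v ^ 'v \<Rightarrow> bool" where
  "Q_polynomial G x A \<longleftrightarrow>
     (\<exists>d E. primitive_idempotent_ordering A d E \<and> Q_polynomial_ordering G x d E)"

end

theory Submission
  imports Defs
begin

text \<open>Let \<open>s = sqrt (n - 1)\<close>. The full bipartite graph of \<open>H(D,n)\<close> with respect to \<open>x\<close> is a Cartesian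
  product of \<open>D\<close> stars \<open>K\<^bsub>1,n-1\<^esub>\<close>, the \<open>i\<close>-th one centred at \<open>x $ i\<close>. Hence \<open>A\<close> is the sum of the
  star matrices \<open>S\<^sub>i\<close>, where \<open>S\<^sub>i\<close> acts on the \<open>i\<close>-th coordinate. Likewise the diagonal matrix
  \<open>A\<^sup>*\<close> of distances from \<open>x\<close> is the sum of the diagonal matrices \<open>a\<^sub>i\<close> that record whether the
  \<open>i\<close>-th coordinate differs from \<open>x $ i\<close>. Its eigenvalues are the distances, so it generates the dual
  adjacency algebra (\<open>generated_subalgebra_distance_matrix\<close>).

  In one star, \<open>S\<^sup>3 = s\<^sup>2 S\<close> and \<open>a S + S a = S\<close>. The first identity makes each \<open>S\<^sub>i\<close>
  diagonalisable; as the \<open>S\<^sub>i\<close> commute, \<open>A\<close> is diagonalisable too (\<open>diagonalisable_sum\<close>). Both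
  identities together give \<open>[S, [S, [S, a]]] = 4s\<^sup>2 [S, a]\<close>, and because matrices belonging to
  different coordinates commute, summation over the coordinates gives
  \<open>[A, [A, [A, A\<^sup>*]]] = (2s)\<^sup>2 [A, A\<^sup>*]\<close> (\<open>commutator_cubic_star\<close>, \<open>commutator_cubic_sum\<close>).

  Multiply this relation by the primitive idempotents for \<open>\<mu>\<close> on the left and \<open>\<theta>\<close> on the right. It
  says that \<open>A\<^sup>*\<close> has a component from the \<open>\<theta>\<close>-eigenspace to the \<open>\<mu>\<close>-eigenspace only if
  \<open>\<mu> - \<theta> \<in> {0, 2s, -2s}\<close> (\<open>tridiagonal_action\<close>). Order the eigenvalues so that those in the same
  class modulo \<open>2s\<close> form an increasing block; then eigenvalues that differ by \<open>2s\<close> are consecutive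
  and the ordering is \<open>Q\<close>-polynomial (\<open>Q_polynomial_if_cubic\<close>). For the
  eigenvalues \<open>s k\<close> with \<open>-D \<le> k \<le> D\<close> this lists the even \<open>k\<close> and then the odd ones.\<close>

section \<open>Bilinearity of the matrix product\<close>

lemma matrix_mult_add_left: "(P + Q) ** R = P ** R + Q ** (R :: real ^ 'u ^ 'v::finite)"
  by (vector matrix_matrix_mult_def sum.distrib[symmetric] field_simps)

lemma matrix_mult_diff_left: "(P - Q) ** R = P ** R - Q ** (R :: real ^ 'u ^ 'v::finite)"
  by (vector matrix_matrix_mult_def sum_subtractf[symmetric] field_simps)

lemma matrix_mult_diff_right: "P ** (Q - R) = P ** Q - P ** (R :: real ^ 'u ^ 'v::finite)"
  by (vector matrix_matrix_mult_def sum_subtractf[symmetric] field_simps)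

lemma matrix_mult_scaleR_left: "(c *\<^sub>R P) ** Q = c *\<^sub>R (P ** (Q :: real ^ 'u ^ 'v::finite))"
  by (simp add: matrix_matrix_mult_def vec_eq_iff sum_distrib_left mult.assoc)

lemma matrix_mult_scaleR_right: "P ** (c *\<^sub>R Q) = c *\<^sub>R (P ** (Q :: real ^ 'u ^ 'v::finite))"
  by (simp add: matrix_matrix_mult_def vec_eq_iff sum_distrib_left mult.left_commute)

lemma matrix_mult_sum_right:
  fixes A :: "real ^ 'v::finite ^ 'v"
  shows "A ** (\<Sum>i\<in>I. P i) = (\<Sum>i\<in>I. A ** P i)"
  by (induction I rule: infinite_finite_induct) (auto simp: matrix_add_ldistrib)

lemma matrix_mult_sum_left:
  fixes A :: "real ^ 'v::finite ^ 'v"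
  shows "(\<Sum>i\<in>I. P i) ** A = (\<Sum>i\<in>I. P i ** A)"
  by (induction I rule: infinite_finite_induct) (auto simp: matrix_mult_add_left)

lemma matrix_vector_mult_sum: "(\<Sum>i\<in>I. P i) *v v = (\<Sum>i\<in>I. P i *v v)"
  by (induction I rule: infinite_finite_induct) (auto simp: matrix_vector_mult_add_rdistrib)

lemma matrix_eq_on_spanning_set:
  fixes P Q :: "real ^ 'v::finite ^ 'w::finite"
  assumes "span S = UNIV" and "\<And>v. v \<in> S \<Longrightarrow> P *v v = Q *v v"
  shows "P = Q"
proof -
  have "P *v v = Q *v v" for v
    by (rule linear_eq_on_span[of "(*v) P" "(*v) Q" S]) (use assms in auto)
  then show ?thesis by (simp add: matrix_eq)
qed

section \<open>Diagonalisable matrices and their primitive idempotents\<close>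

definition eigenspace :: "real ^ 'v ^ 'v \<Rightarrow> real \<Rightarrow> (real ^ 'v) set" where
  "eigenspace A \<theta> = {v. A *v v = \<theta> *\<^sub>R v}"

definition diagonalisable :: "real ^ 'v ^ 'v \<Rightarrow> bool" where
  "diagonalisable A \<longleftrightarrow> (\<exists>\<Theta>. finite \<Theta> \<and> span (\<Union>\<theta>\<in>\<Theta>. eigenspace A \<theta>) = UNIV)"

text \<open>Only the action on eigenvectors is prescribed. As the eigenspaces span, this determines
  \<open>E \<theta>\<close> for \<open>\<theta> \<in> \<Theta>\<close>, and each identity between matrices below is checked on eigenvectors.
  An element of \<open>\<Theta>\<close> may fail to be an eigenvalue; then \<open>E \<theta> = 0\<close>.\<close>

definition spectral_decomposition ::
  "real ^ 'v ^ 'v \<Rightarrow> real set \<Rightarrow> (real \<Rightarrow> real ^ 'v ^ 'v) \<Rightarrow> bool" where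
  "spectral_decomposition A \<Theta> E \<longleftrightarrow>
     finite \<Theta> \<and> span (\<Union>\<theta>\<in>\<Theta>. eigenspace A \<theta>) = UNIV \<and>
     (\<forall>\<theta>\<in>\<Theta>. \<forall>\<mu>\<in>\<Theta>. \<forall>v\<in>eigenspace A \<mu>. E \<theta> *v v = (if \<theta> = \<mu> then v else 0))"

lemma matrix_subalgebra_generated: "matrix_subalgebra (generated_subalgebra A)"
  unfolding generated_subalgebra_def
  by (rule hull_in) (auto simp: matrix_subalgebra_def intro: subspace_Inter)

lemma generator_in_generated_subalgebra: "A \<in> generated_subalgebra A"
  unfolding generated_subalgebra_def by (meson hull_subset insert_subset)

lemma generated_subalgebra_least:
  "matrix_subalgebra M \<Longrightarrow> A \<in> M \<Longrightarrow> generated_subalgebra A \<subseteq> M"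
  unfolding generated_subalgebra_def by (simp add: hull_minimal)

text \<open>The matrix \<open>B\<close> is \<open>p(A)\<close>; only its action on eigenvectors matters here.\<close>

lemma polynomial_in_generated_subalgebra:
  fixes A :: "real ^ 'v::finite ^ 'v"
  shows "\<exists>B\<in>generated_subalgebra A. \<forall>\<theta>. \<forall>v\<in>eigenspace A \<theta>. B *v v = poly p \<theta> *\<^sub>R v"
proof (induction p)
  case 0
  have "0 \<in> generated_subalgebra A"
    using matrix_subalgebra_generated matrix_subalgebra_def subspace_0 by blast
  then show ?case by (intro bexI[of _ 0]) auto
next
  case (pCons a p)
  then obtain B where B: "B \<in> generated_subalgebra A"
      "\<And>\<theta> v. v \<in> eigenspace A \<theta> \<Longrightarrow> B *v v = poly p \<theta> *\<^sub>R v"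
    by blast
  have "a *\<^sub>R mat 1 + A ** B \<in> generated_subalgebra A"
    using matrix_subalgebra_generated[of A] generator_in_generated_subalgebra[of A] B(1)
    by (auto simp: matrix_subalgebra_def intro: subspace_add subspace_scale)
  moreover have "(a *\<^sub>R mat 1 + A ** B) *v v = poly (pCons a p) \<theta> *\<^sub>R v"
    if "v \<in> eigenspace A \<theta>" for v \<theta>
    using B(2)[OF that] that
    by (simp add: eigenspace_def matrix_vector_mult_add_rdistrib scaleR_matrix_vector_assoc[symmetric]
        matrix_vector_mul_assoc[symmetric] scaleR_add_left mult.commute
        linear_cmul[OF matrix_vector_mul_linear])
  ultimately show ?case by blast
qed

lemma polynomial_interpolation:
  fixes f :: "'a::field \<Rightarrow> 'a"
  assumes "finite \<Theta>"
  shows "\<exists>p. \<forall>\<theta>\<in>\<Theta>. poly p \<theta> = f \<theta>"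
  using assms
proof (induction \<Theta>)
  case (insert \<nu> \<Theta>)
  then obtain p where p: "\<forall>\<theta>\<in>\<Theta>. poly p \<theta> = f \<theta>" by blast
  define q where "q = (\<Prod>\<mu>\<in>\<Theta>. [:- \<mu>, 1:])"
  have "poly q \<theta> = 0" if "\<theta> \<in> \<Theta>" for \<theta>
    using that insert.hyps(1) by (auto simp: q_def poly_prod)
  moreover have "poly q \<nu> \<noteq> 0"
    using insert.hyps by (auto simp: q_def poly_prod)
  ultimately have "\<forall>\<theta>\<in>insert \<nu> \<Theta>. poly (p + smult ((f \<nu> - poly p \<nu>) / poly q \<nu>) q) \<theta> = f \<theta>"
    using p by auto
  then show ?case by blast
qed auto

text \<open>Interpolate the indicator function of \<open>\<theta>\<close> on \<open>\<Theta>\<close> by a polynomial and evaluate it at \<open>A\<close>.\<close>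

lemma eigenprojection_exists:
  fixes A :: "real ^ 'v::finite ^ 'v"
  assumes "finite \<Theta>"
  shows "\<exists>B\<in>generated_subalgebra A. \<forall>\<mu>\<in>\<Theta>. \<forall>v\<in>eigenspace A \<mu>. B *v v = (if \<theta> = \<mu> then v else 0)"
proof -
  obtain p where p: "\<forall>\<mu>\<in>\<Theta>. poly p \<mu> = (if \<theta> = \<mu> then 1 else 0)"
    using polynomial_interpolation[OF assms, of "\<lambda>\<mu>. if \<theta> = \<mu> then 1 else 0"] by blast
  obtain B where "B \<in> generated_subalgebra A"
      "\<forall>\<mu>. \<forall>v\<in>eigenspace A \<mu>. B *v v = poly p \<mu> *\<^sub>R v"
    using polynomial_in_generated_subalgebra by blast
  then show ?thesis
    using p by (intro bexI[of _ B]) auto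
qed

lemma diagonalisable_imp_spectral_decomposition:
  fixes A :: "real ^ 'v::finite ^ 'v"
  assumes "diagonalisable A"
  obtains \<Theta> E where "spectral_decomposition A \<Theta> E" and "\<And>\<theta>. \<theta> \<in> \<Theta> \<Longrightarrow> eigenspace A \<theta> \<noteq> {0}"
proof -
  obtain \<Theta>0 where \<Theta>0: "finite \<Theta>0" "span (\<Union>\<theta>\<in>\<Theta>0. eigenspace A \<theta>) = UNIV"
    using assms by (auto simp: diagonalisable_def)
  define \<Theta> where "\<Theta> = {\<theta>\<in>\<Theta>0. eigenspace A \<theta> \<noteq> {0}}"
  have "finite \<Theta>" using \<Theta>0 by (simp add: \<Theta>_def)
  moreover have "span (\<Union>\<theta>\<in>\<Theta>. eigenspace A \<theta>) = UNIV"
  proof -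
    have "(\<Union>\<theta>\<in>\<Theta>0. eigenspace A \<theta>) \<subseteq> span (\<Union>\<theta>\<in>\<Theta>. eigenspace A \<theta>)"
    proof
      fix v assume "v \<in> (\<Union>\<theta>\<in>\<Theta>0. eigenspace A \<theta>)"
      then obtain \<theta> where "\<theta> \<in> \<Theta>0" "v \<in> eigenspace A \<theta>" by blast
      then show "v \<in> span (\<Union>\<theta>\<in>\<Theta>. eigenspace A \<theta>)"
        by (cases "eigenspace A \<theta> = {0}") (auto simp: \<Theta>_def span_zero intro!: span_base)
    qed
    then have "span (\<Union>\<theta>\<in>\<Theta>0. eigenspace A \<theta>) \<subseteq> span (\<Union>\<theta>\<in>\<Theta>. eigenspace A \<theta>)"
      by (rule span_minimal) auto
    with \<Theta>0 show ?thesis by auto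
  qed
  moreover obtain E where
    "\<forall>\<theta>. \<forall>\<mu>\<in>\<Theta>. \<forall>v\<in>eigenspace A \<mu>. E \<theta> *v v = (if \<theta> = \<mu> then v else 0)"
    using eigenprojection_exists[OF \<open>finite \<Theta>\<close>, of A] by metis
  ultimately have "spectral_decomposition A \<Theta> E" by (simp add: spectral_decomposition_def)
  then show thesis by (rule that) (simp add: \<Theta>_def)
qed

context
  fixes A :: "real ^ 'v::finite ^ 'v" and \<Theta> E
  assumes spec: "spectral_decomposition A \<Theta> E"
begin

lemma spectral_finite: "finite \<Theta>"
  using spec by (simp add: spectral_decomposition_def)

lemma spectral_apply:
  "\<theta> \<in> \<Theta> \<Longrightarrow> \<mu> \<in> \<Theta> \<Longrightarrow> v \<in> eigenspace A \<mu> \<Longrightarrow> E \<theta> *v v = (if \<theta> = \<mu> then v else 0)"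
  using spec by (simp add: spectral_decomposition_def)

lemma matrix_eq_on_eigenspaces:
  assumes "\<And>\<mu> v. \<mu> \<in> \<Theta> \<Longrightarrow> v \<in> eigenspace A \<mu> \<Longrightarrow> P *v v = Q *v v"
  shows "P = (Q :: real ^ 'v ^ 'v)"
  by (rule matrix_eq_on_spanning_set[of "\<Union>\<theta>\<in>\<Theta>. eigenspace A \<theta>"])
     (use assms spec in \<open>auto simp: spectral_decomposition_def\<close>)

lemma spectral_sum: "(\<Sum>\<theta>\<in>\<Theta>. E \<theta>) = mat 1"
  by (rule matrix_eq_on_eigenspaces)
     (simp add: matrix_vector_mult_sum spectral_apply spectral_finite sum.delta' cong: sum.cong)

lemma spectral_mult:
  "\<theta> \<in> \<Theta> \<Longrightarrow> \<mu> \<in> \<Theta> \<Longrightarrow> E \<theta> ** E \<mu> = (if \<theta> = \<mu> then E \<theta> else 0)"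
  by (rule matrix_eq_on_eigenspaces)
     (auto simp: matrix_vector_mul_assoc[symmetric] spectral_apply)

lemma spectral_mult_right: "\<theta> \<in> \<Theta> \<Longrightarrow> E \<theta> ** A = \<theta> *\<^sub>R E \<theta>"
  by (rule matrix_eq_on_eigenspaces)
     (auto simp: matrix_vector_mul_assoc[symmetric] spectral_apply eigenspace_def
       scaleR_matrix_vector_assoc[symmetric] linear_cmul[OF matrix_vector_mul_linear])

lemma spectral_mult_left: "\<theta> \<in> \<Theta> \<Longrightarrow> A ** E \<theta> = \<theta> *\<^sub>R E \<theta>"
  by (rule matrix_eq_on_eigenspaces)
     (auto simp: matrix_vector_mul_assoc[symmetric] spectral_apply eigenspace_def
       scaleR_matrix_vector_assoc[symmetric])

lemma spectral_in_eigenspace: "\<theta> \<in> \<Theta> \<Longrightarrow> E \<theta> *v v \<in> eigenspace A \<theta>"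
  by (simp add: eigenspace_def matrix_vector_mul_assoc spectral_mult_left
      scaleR_matrix_vector_assoc)

lemma spectral_in_generated_subalgebra:
  assumes "\<theta> \<in> \<Theta>"
  shows "E \<theta> \<in> generated_subalgebra A"
proof -
  obtain B where B: "B \<in> generated_subalgebra A"
      "\<forall>\<mu>\<in>\<Theta>. \<forall>v\<in>eigenspace A \<mu>. B *v v = (if \<theta> = \<mu> then v else 0)"
    using eigenprojection_exists[OF spectral_finite] by blast
  have "E \<theta> = B"
    by (rule matrix_eq_on_eigenspaces) (use B(2) assms in \<open>auto simp: spectral_apply\<close>)
  with B(1) show ?thesis by simp
qed

text \<open>Closure under products reduces by bilinearity to the products \<open>E \<theta> ** E \<mu>\<close>.\<close>

lemma matrix_subalgebra_span_spectral: "matrix_subalgebra (span (E ` \<Theta>))"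
proof -
  have "(\<Sum>\<theta>\<in>\<Theta>. E \<theta>) \<in> span (E ` \<Theta>)"
    by (intro span_sum span_base) auto
  moreover have "B ** C \<in> span (E ` \<Theta>)" if B: "B \<in> span (E ` \<Theta>)" and C: "C \<in> span (E ` \<Theta>)" for B C
    using B
  proof (induction rule: span_induct_alt)
    case base
    then show ?case by (simp add: span_zero)
  next
    case (step c P Q)
    have "P ** C \<in> span (E ` \<Theta>)"
      using C
    proof (induction rule: span_induct_alt)
      case base
      then show ?case by (simp add: span_zero)
    next
      case (step c Q R)
      then obtain \<theta> \<mu> where "\<theta> \<in> \<Theta>" "\<mu> \<in> \<Theta>" "P = E \<theta>" "Q = E \<mu>"
        using \<open>P \<in> E ` \<Theta>\<close> by blast
      then have "P ** Q \<in> span (E ` \<Theta>)"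
        by (auto simp: spectral_mult span_zero intro: span_base)
      with step show ?case
        by (simp add: matrix_add_ldistrib matrix_mult_scaleR_right span_add span_scale)
    qed
    with step show ?case
      by (simp add: matrix_mult_add_left matrix_mult_scaleR_left span_add span_scale)
  qed
  ultimately show ?thesis
    by (simp add: matrix_subalgebra_def spectral_sum)
qed

text \<open>This is used twice: for the adjacency matrix it yields the primitive idempotents, and for the
  diagonal matrix of distances it yields the dual adjacency algebra.\<close>

lemma generated_subalgebra_spectral: "generated_subalgebra A = span (E ` \<Theta>)"
proof
  have "A = (\<Sum>\<theta>\<in>\<Theta>. \<theta> *\<^sub>R E \<theta>)"
    by (rule matrix_eq_on_eigenspaces)
      (simp add: matrix_vector_mult_sum spectral_apply spectral_finite sum.delta' eigenspace_def
        scaleR_matrix_vector_assoc[symmetric] if_distrib[of "(*\<^sub>R) _"] cong: sum.cong if_cong)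
  also have "\<dots> \<in> span (E ` \<Theta>)"
    by (intro span_sum span_scale span_base) auto
  finally show "generated_subalgebra A \<subseteq> span (E ` \<Theta>)"
    by (intro generated_subalgebra_least matrix_subalgebra_span_spectral)
  show "span (E ` \<Theta>) \<subseteq> generated_subalgebra A"
    by (rule span_minimal)
       (use spectral_in_generated_subalgebra matrix_subalgebra_generated matrix_subalgebra_def in auto)
qed

lemma spectral_independent:
  assumes "\<And>\<theta>. \<theta> \<in> \<Theta> \<Longrightarrow> eigenspace A \<theta> \<noteq> {0}"
  shows "inj_on E \<Theta>" and "independent (E ` \<Theta>)"
proof -
  have ev: "\<exists>v\<in>eigenspace A \<theta>. v \<noteq> 0" if "\<theta> \<in> \<Theta>" for \<theta>
  proof -
    have "0 \<in> eigenspace A \<theta>" by (simp add: eigenspace_def)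
    then show ?thesis using assms[OF that] by blast
  qed
  show inj: "inj_on E \<Theta>"
  proof (rule inj_onI, rule ccontr)
    fix \<theta> \<mu> assume *: "\<theta> \<in> \<Theta>" "\<mu> \<in> \<Theta>" "E \<theta> = E \<mu>" "\<theta> \<noteq> \<mu>"
    then show False
      using ev[of \<theta>] spectral_apply[of \<theta> \<theta>] spectral_apply[of \<mu> \<theta>] by auto
  qed
  have "u (E \<mu>) = 0" if 0: "(\<Sum>F\<in>E ` \<Theta>. u F *\<^sub>R F) = 0" and \<mu>: "\<mu> \<in> \<Theta>" for u \<mu>
  proof -
    obtain v where v: "v \<in> eigenspace A \<mu>" "v \<noteq> 0" using ev[OF \<mu>] by blast
    have "(\<Sum>\<theta>\<in>\<Theta>. u (E \<theta>) *\<^sub>R E \<theta>) = 0"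
      using 0 by (simp add: sum.reindex[OF inj] o_def)
    then have "(\<Sum>\<theta>\<in>\<Theta>. u (E \<theta>) *\<^sub>R E \<theta>) *v v = 0" by simp
    moreover have "(\<Sum>\<theta>\<in>\<Theta>. u (E \<theta>) *\<^sub>R E \<theta>) *v v = u (E \<mu>) *\<^sub>R v"
      using \<mu> v(1)
      by (simp add: matrix_vector_mult_sum spectral_apply spectral_finite sum.delta'
        scaleR_matrix_vector_assoc[symmetric] if_distrib[of "(*\<^sub>R) _"] cong: sum.cong if_cong)
    ultimately show ?thesis using v(2) by simp
  qed
  then show "independent (E ` \<Theta>)"
    using spectral_finite by (auto simp: dependent_finite)
qed

end

text \<open>The primitive idempotents of \<open>S\<close> are polynomials in \<open>S\<close> and so commute with \<open>B\<close>; they split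
  every eigenvector of \<open>B\<close> into joint eigenvectors of \<open>B\<close> and \<open>S\<close>.\<close>

lemma diagonalisable_add:
  fixes B S :: "real ^ 'v::finite ^ 'v"
  assumes B: "diagonalisable B" and S: "diagonalisable S" and comm: "B ** S = S ** B"
  shows "diagonalisable (B + S)"
proof -
  obtain \<Theta> where \<Theta>: "finite \<Theta>" "span (\<Union>\<theta>\<in>\<Theta>. eigenspace B \<theta>) = UNIV"
    using B by (auto simp: diagonalisable_def)
  obtain \<Sigma> E where spec: "spectral_decomposition S \<Sigma> E"
    using diagonalisable_imp_spectral_decomposition[OF S] by blast
  have "matrix_subalgebra {C. B ** C = C ** B}"
    by (auto simp: matrix_subalgebra_def subspace_def matrix_add_ldistrib matrix_mult_add_left
        matrix_mult_scaleR_left matrix_mult_scaleR_right) (metis matrix_mul_assoc)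
  then have "generated_subalgebra S \<subseteq> {C. B ** C = C ** B}"
    by (rule generated_subalgebra_least) (simp add: comm)
  then have E_comm: "B ** E \<sigma> = E \<sigma> ** B" if "\<sigma> \<in> \<Sigma>" for \<sigma>
    using spectral_in_generated_subalgebra[OF spec that] by blast
  define \<Lambda> where "\<Lambda> = (\<lambda>(\<theta>, \<sigma>). \<theta> + \<sigma>) ` (\<Theta> \<times> \<Sigma>)"
  have "finite \<Lambda>"
    using \<Theta>(1) spectral_finite[OF spec] by (simp add: \<Lambda>_def)
  moreover have "span (\<Union>\<kappa>\<in>\<Lambda>. eigenspace (B + S) \<kappa>) = UNIV"
  proof -
    have "v \<in> span (\<Union>\<kappa>\<in>\<Lambda>. eigenspace (B + S) \<kappa>)" if \<theta>: "\<theta> \<in> \<Theta>" and v: "v \<in> eigenspace B \<theta>" for \<theta> v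
    proof -
      have "E \<sigma> *v v \<in> eigenspace (B + S) (\<theta> + \<sigma>)" if \<sigma>: "\<sigma> \<in> \<Sigma>" for \<sigma>
      proof -
        have "B *v (E \<sigma> *v v) = \<theta> *\<^sub>R (E \<sigma> *v v)"
          using v by (simp add: matrix_vector_mul_assoc E_comm[OF \<sigma>])
            (simp add: matrix_vector_mul_assoc[symmetric] eigenspace_def
              linear_cmul[OF matrix_vector_mul_linear])
        moreover have "S *v (E \<sigma> *v v) = \<sigma> *\<^sub>R (E \<sigma> *v v)"
          using spectral_in_eigenspace[OF spec \<sigma>] by (simp add: eigenspace_def)
        ultimately show ?thesis
          by (simp add: eigenspace_def matrix_vector_mult_add_rdistrib scaleR_add_left)
      qed
      moreover have "\<theta> + \<sigma> \<in> \<Lambda>" if "\<sigma> \<in> \<Sigma>" for \<sigma>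
        using that \<theta> by (force simp: \<Lambda>_def)
      ultimately have "(\<Sum>\<sigma>\<in>\<Sigma>. E \<sigma> *v v) \<in> span (\<Union>\<kappa>\<in>\<Lambda>. eigenspace (B + S) \<kappa>)"
        by (intro span_sum span_base) blast
      then show ?thesis
        by (simp add: matrix_vector_mult_sum[symmetric] spectral_sum[OF spec])
    qed
    then have "span (\<Union>\<theta>\<in>\<Theta>. eigenspace B \<theta>) \<subseteq> span (\<Union>\<kappa>\<in>\<Lambda>. eigenspace (B + S) \<kappa>)"
      by (intro span_minimal) auto
    then show ?thesis using \<Theta>(2) by auto
  qed
  ultimately show ?thesis by (auto simp: diagonalisable_def)
qed

lemma diagonalisable_zero: "diagonalisable (0 :: real ^ 'v::finite ^ 'v)"
  by (auto simp: diagonalisable_def eigenspace_def intro!: exI[of _ "{0}"])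

lemma diagonalisable_sum:
  fixes S :: "'i \<Rightarrow> real ^ 'v::finite ^ 'v"
  assumes "finite I" and "\<And>i. i \<in> I \<Longrightarrow> diagonalisable (S i)"
    and "\<And>i j. i \<in> I \<Longrightarrow> j \<in> I \<Longrightarrow> S i ** S j = S j ** S i"
  shows "diagonalisable (\<Sum>i\<in>I. S i)"
  using assms
proof (induction I)
  case empty
  then show ?case by (simp add: diagonalisable_zero)
next
  case (insert i I)
  have "S i ** (\<Sum>j\<in>I. S j) = (\<Sum>j\<in>I. S j) ** S i"
    unfolding matrix_mult_sum_left matrix_mult_sum_right
    by (rule sum.cong) (use insert.prems(2) in auto)
  then have "diagonalisable (S i + (\<Sum>j\<in>I. S j))"
    using insert by (intro diagonalisable_add) auto
  then show ?case using insert.hyps by simp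
qed

text \<open>The polynomial \<open>X\<^sup>3 - s\<^sup>2 X\<close> has the three distinct roots \<open>0\<close>, \<open>s\<close>, \<open>-s\<close>, and
  the three summands of \<open>v\<close> below are its Lagrange projections.\<close>

lemma diagonalisable_cube:
  fixes S :: "real ^ 'v::finite ^ 'v"
  assumes cube: "S ** S ** S = (s^2) *\<^sub>R S" and "s \<noteq> 0"
  shows "diagonalisable S"
proof -
  have "v \<in> span (\<Union>\<theta>\<in>{0, s, - s}. eigenspace S \<theta>)" for v
  proof -
    define v1 where "v1 = S *v v"
    define v2 where "v2 = S *v v1"
    have S2: "S *v v2 = s^2 *\<^sub>R v1"
      unfolding v1_def v2_def
      by (simp add: matrix_vector_mul_assoc matrix_mul_assoc cube scaleR_matrix_vector_assoc)
    have e: "v - (1 / s^2) *\<^sub>R v2 \<in> eigenspace S 0"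
      "(1/(2 * s^2)) *\<^sub>R (v2 + s *\<^sub>R v1) \<in> eigenspace S s"
      "(1/(2 * s^2)) *\<^sub>R (v2 - s *\<^sub>R v1) \<in> eigenspace S (- s)"
      using \<open>s \<noteq> 0\<close>
      by (auto simp: eigenspace_def matrix_vector_mult_diff_distrib matrix_vector_right_distrib
          linear_cmul[OF matrix_vector_mul_linear] S2 v1_def[symmetric] v2_def[symmetric]
          scaleR_add_right scaleR_diff_right power2_eq_square)
    have "v = (v - (1 / s^2) *\<^sub>R v2) +
        ((1/(2 * s^2)) *\<^sub>R (v2 + s *\<^sub>R v1) + (1/(2 * s^2)) *\<^sub>R (v2 - s *\<^sub>R v1))"
      using \<open>s \<noteq> 0\<close> by (simp add: vec_eq_iff field_simps)
    also have "\<dots> \<in> span (\<Union>\<theta>\<in>{0, s, - s}. eigenspace S \<theta>)"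
      by (intro span_add span_base) (use e in auto)
    finally show ?thesis .
  qed
  then show ?thesis
    by (auto simp: diagonalisable_def intro!: exI[of _ "{0, s, - s}"])
qed

section \<open>A cubic commutator relation implies the Q-polynomial property\<close>

text \<open>Values that differ by \<open>c\<close> lie in the same class modulo \<open>c\<close>. List the classes one after the
  other, each in increasing order: nothing in \<open>\<Theta>\<close> can then come between \<open>\<theta>\<close> and \<open>\<theta> + c\<close>.
  The rank of an element for this order is its position in the list.\<close>

lemma difference_adapted_enumeration:
  fixes \<Theta> :: "real set" and c :: real
  assumes "finite \<Theta>" and "c > 0"
  obtains e :: "nat \<Rightarrow> real" where "bij_betw e {..<card \<Theta>} \<Theta>"
    and "\<And>i j. i < card \<Theta> \<Longrightarrow> j < card \<Theta> \<Longrightarrow> e j = e i + c \<Longrightarrow> j = Suc i"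
proof -
  define less where "less \<theta> \<mu> \<longleftrightarrow>
      frac (\<theta> / c) < frac (\<mu> / c) \<or> frac (\<theta> / c) = frac (\<mu> / c) \<and> \<theta> < \<mu>" for \<theta> \<mu> :: real
  have less_trans: "less \<theta> \<mu> \<Longrightarrow> less \<mu> \<nu> \<Longrightarrow> less \<theta> \<nu>"
    and less_irrefl: "\<not> less \<theta> \<theta>" and less_total: "\<theta> \<noteq> \<mu> \<Longrightarrow> less \<theta> \<mu> \<or> less \<mu> \<theta>" for \<theta> \<mu> \<nu>
    by (auto simp: less_def)
  define rank where "rank \<theta> = card {\<mu>\<in>\<Theta>. less \<mu> \<theta>}" for \<theta>
  have rank_mono: "rank \<theta> < rank \<mu>" if "less \<theta> \<mu>" "\<theta> \<in> \<Theta>" for \<theta> \<mu>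
  proof -
    have "{\<nu>\<in>\<Theta>. less \<nu> \<theta>} \<subseteq> {\<nu>\<in>\<Theta>. less \<nu> \<mu>}"
      using that(1) less_trans by blast
    moreover have "\<theta> \<in> {\<nu>\<in>\<Theta>. less \<nu> \<mu>} - {\<nu>\<in>\<Theta>. less \<nu> \<theta>}"
      using that less_irrefl by blast
    ultimately show ?thesis
      unfolding rank_def by (intro psubset_card_mono) (use assms(1) in auto)
  qed
  have inj: "inj_on rank \<Theta>"
    by (rule inj_onI) (metis less_total rank_mono less_irrefl_nat)
  have "rank ` \<Theta> \<subseteq> {..<card \<Theta>}"
    unfolding rank_def using less_irrefl by (auto intro!: psubset_card_mono assms(1))
  then have "rank ` \<Theta> = {..<card \<Theta>}"
    by (intro card_subset_eq) (auto simp: card_image[OF inj])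
  with inj have bij: "bij_betw rank \<Theta> {..<card \<Theta>}" by (simp add: bij_betw_def)
  define e where "e = inv_into \<Theta> rank"
  have e_bij: "bij_betw e {..<card \<Theta>} \<Theta>"
    unfolding e_def by (rule bij_betw_inv_into[OF bij])
  have rank_e: "rank (e i) = i" if "i < card \<Theta>" for i
    using bij that unfolding e_def by (simp add: bij_betw_inv_into_right)
  have "j = Suc i" if i: "i < card \<Theta>" and j: "j < card \<Theta>" and ij: "e j = e i + c" for i j
  proof -
    have frac_eq: "frac ((e i + c) / c) = frac (e i / c)"
      using \<open>c > 0\<close> by (simp add: add_divide_distrib frac_def)
    have "less \<mu> (e i + c) \<longleftrightarrow> \<mu> = e i \<or> less \<mu> (e i)" for \<mu>
    proof -
      have "\<mu> \<le> e i" if "frac (\<mu> / c) = frac (e i / c)" "\<mu> < e i + c"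
      proof -
        have "\<mu> / c < e i / c + 1" using \<open>c > 0\<close> that(2) by (simp add: field_simps)
        then have "real_of_int \<lfloor>\<mu> / c\<rfloor> < \<lfloor>e i / c\<rfloor> + 1"
          using that(1) by (simp add: frac_def)
        then have "\<lfloor>\<mu> / c\<rfloor> \<le> \<lfloor>e i / c\<rfloor>" by linarith
        then have "\<mu> / c \<le> e i / c" using that(1) by (simp add: frac_def)
        then show ?thesis using \<open>c > 0\<close> by (simp add: divide_le_cancel)
      qed
      then show ?thesis using \<open>c > 0\<close> by (auto simp: less_def frac_eq)
    qed
    \<comment> \<open>The only predecessor of \<open>e i + c\<close> that is not one of \<open>e i\<close> is \<open>e i\<close> itself.\<close>
    then have "{\<mu>\<in>\<Theta>. less \<mu> (e j)} = insert (e i) {\<mu>\<in>\<Theta>. less \<mu> (e i)}"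
      using ij bij_betwE[OF e_bij] i by auto
    then have "rank (e j) = Suc (rank (e i))"
      unfolding rank_def using assms(1) less_irrefl by simp
    then show ?thesis using rank_e i j by simp
  qed
  with e_bij show thesis by (rule that)
qed

definition commutator :: "real ^ 'v ^ 'v \<Rightarrow> real ^ 'v ^ 'v \<Rightarrow> real ^ 'v ^ 'v" where
  "commutator A B = A ** B - B ** A"

lemma commutator_eigen:
  fixes A B :: "real ^ 'v::finite ^ 'v"
  assumes "spectral_decomposition A \<Theta> E" and "\<mu> \<in> \<Theta>" and "v \<in> eigenspace A \<theta>"
  shows "E \<mu> *v (commutator A B *v v) = (\<mu> - \<theta>) *\<^sub>R (E \<mu> *v (B *v v))"
proof -
  have "E \<mu> *v (A *v (B *v v)) = \<mu> *\<^sub>R (E \<mu> *v (B *v v))"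
    using spectral_mult_right[OF assms(1,2)]
    by (metis matrix_vector_mul_assoc scaleR_matrix_vector_assoc)
  moreover have "A *v v = \<theta> *\<^sub>R v" using assms(3) by (simp add: eigenspace_def)
  ultimately show ?thesis
    by (simp add: commutator_def matrix_vector_mult_diff_rdistrib matrix_vector_mul_assoc[symmetric]
        matrix_vector_mult_diff_distrib scaleR_diff_left linear_cmul[OF matrix_vector_mul_linear])
qed

text \<open>Between eigenspaces for \<open>\<mu>\<close> and \<open>\<theta>\<close>, taking the commutator with \<open>A\<close> multiplies
  by \<open>\<mu> - \<theta>\<close>. The cubic relation therefore forces \<open>(\<mu> - \<theta>)\<^sup>3 = c\<^sup>2 (\<mu> - \<theta>)\<close> wherever
  \<open>B\<close> has a nonzero component.\<close>

lemma tridiagonal_action: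
  fixes A B :: "real ^ 'v::finite ^ 'v"
  assumes spec: "spectral_decomposition A \<Theta> E" and "\<mu> \<in> \<Theta>" and v: "v \<in> eigenspace A \<theta>"
    and cubic: "commutator A (commutator A (commutator A B)) = c^2 *\<^sub>R commutator A B"
    and nz: "E \<mu> *v (B *v v) \<noteq> 0"
  shows "\<mu> = \<theta> \<or> \<mu> = \<theta> + c \<or> \<theta> = \<mu> + c"
proof -
  note ce = commutator_eigen[OF spec \<open>\<mu> \<in> \<Theta>\<close> v]
  have "E \<mu> *v (commutator A (commutator A (commutator A B)) *v v)
      = (\<mu> - \<theta>)^3 *\<^sub>R (E \<mu> *v (B *v v))"
    unfolding ce by (simp add: power3_eq_cube)
  moreover have "E \<mu> *v ((c^2 *\<^sub>R commutator A B) *v v) = (c^2 * (\<mu> - \<theta>)) *\<^sub>R (E \<mu> *v (B *v v))"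
    by (simp add: scaleR_matrix_vector_assoc[symmetric] ce linear_cmul[OF matrix_vector_mul_linear])
  ultimately have "(\<mu> - \<theta>)^3 = c^2 * (\<mu> - \<theta>)"
    using nz cubic by simp
  then have "(\<mu> - \<theta>) * ((\<mu> - \<theta> - c) * (\<mu> - \<theta> + c)) = 0"
    by (simp add: power3_eq_cube power2_eq_square algebra_simps)
  then show ?thesis by auto
qed

text \<open>By \<open>tridiagonal_action\<close>, \<open>B\<close> moves an eigenvalue by \<open>0\<close> or \<open>\<plusminus>c\<close> only, and
  \<open>difference_adapted_enumeration\<close> orders the eigenvalues so that these moves reach at most the
  two neighbours. Where consecutive eigenvalues do not differ by \<open>c\<close>, the component
  between them is zero, which the \<open>Q\<close>-polynomial property permits.\<close>

theorem Q_polynomial_if_cubic: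
  fixes G :: "('v::finite \<times> 'v) set" and A B :: "real ^ 'v ^ 'v"
  assumes diag: "diagonalisable A"
    and gen: "generated_subalgebra B = dual_adjacency_algebra G x"
    and cubic: "commutator A (commutator A (commutator A B)) = c^2 *\<^sub>R commutator A B"
    and "c > 0"
  shows "Q_polynomial G x A"
proof -
  obtain \<Theta> F where spec: "spectral_decomposition A \<Theta> F"
    and nontriv: "\<And>\<theta>. \<theta> \<in> \<Theta> \<Longrightarrow> eigenspace A \<theta> \<noteq> {0}"
    using diagonalisable_imp_spectral_decomposition[OF diag] by blast
  obtain e where e_bij: "bij_betw e {..<card \<Theta>} \<Theta>"
    and e_step: "\<And>i j. i < card \<Theta> \<Longrightarrow> j < card \<Theta> \<Longrightarrow> e j = e i + c \<Longrightarrow> j = Suc i"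
    using difference_adapted_enumeration[OF spectral_finite[OF spec] \<open>c > 0\<close>] by blast
  have "\<Theta> \<noteq> {}"
  proof
    assume "\<Theta> = {}"
    then have "(mat 1 :: real ^ 'v ^ 'v) = 0" using spectral_sum[OF spec] by simp
    then have "(mat 1 :: real ^ 'v ^ 'v) $ x $ x = 0" by simp
    then show False by (simp add: mat_def)
  qed
  define d where "d = card \<Theta> - 1"
  have card: "card \<Theta> = Suc d"
    using \<open>\<Theta> \<noteq> {}\<close> spectral_finite[OF spec] by (simp add: d_def card_gt_0_iff)
  define E where "E i = (if i \<in> {0..int d} then F (e (nat i)) else 0)" for i
  have bij: "bij_betw (\<lambda>i. e (nat i)) {0..int d} \<Theta>"
  proof -
    have "bij_betw nat {0..int d} {..<card \<Theta>}"
      unfolding card by (rule bij_betw_byWitness[of _ int]) auto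
    then show ?thesis using bij_betw_trans[OF _ e_bij] by (simp add: o_def)
  qed
  have E_outside: "E i = 0" if "i \<notin> {0..int d}" for i
    using that by (auto simp: E_def)
  have e_in: "e (nat i) \<in> \<Theta>" if "i \<in> {0..int d}" for i
    using bij_betwE[OF bij] that by blast
  have image: "E ` {0..int d} = F ` \<Theta>"
    using bij_betw_imp_surj_on[OF bij] by (force simp: E_def)
  have sum: "(\<Sum>i\<in>{0..int d}. E i) = mat 1"
    using sum.reindex_bij_betw[OF bij, of F] spectral_sum[OF spec] by (simp add: E_def)
  have "primitive_idempotent_ordering A d E"
    unfolding primitive_idempotent_ordering_def
  proof (intro conjI ballI)
    have "inj_on (F \<circ> (\<lambda>i. e (nat i))) {0..int d}"
      using bij spectral_independent(1)[OF spec nontriv] by (auto simp: bij_betw_def intro: comp_inj_on)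
    then show "inj_on E {0..int d}"
      by (rule inj_on_cong[THEN iffD1, rotated]) (simp add: E_def)
    show "independent (E ` {0..int d})" "span (E ` {0..int d}) = generated_subalgebra A"
      unfolding image using spectral_independent(2)[OF spec nontriv] generated_subalgebra_spectral[OF spec]
      by auto
    show "(\<Sum>i\<in>{0..int d}. E i) = mat 1" by (rule sum)
    show "E i ** E j = (if i = j then E i else 0)" if "i \<in> {0..int d}" "j \<in> {0..int d}" for i j
      using spectral_mult[OF spec e_in[OF that(1)] e_in[OF that(2)]]
        bij_betw_imp_inj_on[OF bij] that
      by (auto simp: E_def dest: inj_onD)
  qed (auto simp: E_def)
  moreover have "dual_adjacency_matrix G x d E B"
    unfolding dual_adjacency_matrix_def
  proof (intro conjI ballI gen)
    fix i assume i: "i \<in> {0..int d}"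
    have near: "j \<in> {i - 1, i, i + 1}"
      if j: "j \<in> {0..int d}" and nz: "E j *v (B *v (E i *v v)) \<noteq> 0" for j v
    proof -
      have "E i *v v \<in> eigenspace A (e (nat i))"
        using spectral_in_eigenspace[OF spec e_in[OF i]] i by (simp add: E_def)
      then have "e (nat j) = e (nat i) \<or> e (nat j) = e (nat i) + c \<or> e (nat i) = e (nat j) + c"
        using tridiagonal_action[OF spec e_in[OF j] _ cubic] nz j by (simp add: E_def)
      moreover have "nat i < card \<Theta>" "nat j < card \<Theta>" using i j card by auto
      ultimately have "nat j = nat i \<or> nat j = Suc (nat i) \<or> nat i = Suc (nat j)"
        using e_step e_bij by (auto simp: bij_betw_def dest: inj_onD)
      then show ?thesis using i j by auto
    qed
    show "(\<lambda>v. B *v v) ` matrix_image (E i) \<subseteq>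
        {u + v + w | u v w. u \<in> matrix_image (E (i - 1)) \<and> v \<in> matrix_image (E i) \<and>
                            w \<in> matrix_image (E (i + 1))}"
    proof
      fix y assume "y \<in> (\<lambda>v. B *v v) ` matrix_image (E i)"
      then obtain v where y: "y = B *v (E i *v v)" by (auto simp: matrix_image_def)
      have "y = (\<Sum>j\<in>{0..int d}. E j *v y)"
        by (simp add: matrix_vector_mult_sum[symmetric] sum)
      also have "\<dots> = (\<Sum>j\<in>{i - 1, i, i + 1}. E j *v y)"
        by (rule sum.mono_neutral_cong)
          (use near[of _ v] in \<open>auto simp: y E_outside simp del: atLeastAtMost_iff insert_iff\<close>)
      also have "\<dots> = E (i - 1) *v y + E i *v y + E (i + 1) *v y"
        by simp
      finally show "y \<in> {u + v + w | u v w. u \<in> matrix_image (E (i - 1)) \<and> v \<in> matrix_image (E i) \<and>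
                            w \<in> matrix_image (E (i + 1))}"
        unfolding matrix_image_def by blast
    qed
  qed
  ultimately show ?thesis by (auto simp: Q_polynomial_def Q_polynomial_ordering_def)
qed

section \<open>The star matrices of the coordinates\<close>

definition replace_coordinate :: "'s ^ 'd \<Rightarrow> 'd \<Rightarrow> 's \<Rightarrow> 's ^ 'd" where
  "replace_coordinate y i c = (\<chi> j. if j = i then c else y $ j)"

lemma replace_coordinate_nth [simp]: "replace_coordinate y i c $ j = (if j = i then c else y $ j)"
  by (simp add: replace_coordinate_def)

lemma replace_coordinate_same [simp]:
  "replace_coordinate (replace_coordinate y i c) i c' = replace_coordinate y i c'"
  by (simp add: vec_eq_iff)

lemma replace_coordinate_commute:
  "i \<noteq> j \<Longrightarrow>
    replace_coordinate (replace_coordinate y i c) j c' =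
    replace_coordinate (replace_coordinate y j c') i c"
  by (simp add: vec_eq_iff)

text \<open>On the \<open>i\<close>-th coordinate this is the adjacency matrix of the star \<open>K\<^bsub>1,n-1\<^esub>\<close> with centre
  \<open>x $ i\<close>, and on the other coordinates it is the identity.\<close>

definition star_matrix :: "'s::finite ^ 'd::finite \<Rightarrow> 'd \<Rightarrow> real ^ ('s ^ 'd) ^ ('s ^ 'd)" where
  "star_matrix x i = (\<chi> y z. if (\<forall>j. j \<noteq> i \<longrightarrow> y $ j = z $ j) \<and> (y $ i = x $ i) \<noteq> (z $ i = x $ i)
                             then 1 else 0)"

definition coordinate_matrix :: "'s::finite ^ 'd::finite \<Rightarrow> 'd \<Rightarrow> real ^ ('s ^ 'd) ^ ('s ^ 'd)" where
  "coordinate_matrix x i = (\<chi> y z. if y = z \<and> y $ i \<noteq> x $ i then 1 else 0)"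

text \<open>The form in which products of star matrices can be computed: a product becomes an iterated sum
  over letters instead of a sum over vertices.\<close>

lemma star_matrix_apply:
  "(star_matrix x i *v v) $ y = (\<Sum>c | (c = x $ i) \<noteq> (y $ i = x $ i). v $ replace_coordinate y i c)"
proof -
  let ?N = "{c. (c = x $ i) \<noteq> (y $ i = x $ i)}"
  let ?Z = "{z. (\<forall>j. j \<noteq> i \<longrightarrow> y $ j = z $ j) \<and> (y $ i = x $ i) \<noteq> (z $ i = x $ i)}"
  have "(star_matrix x i *v v) $ y = (\<Sum>z\<in>UNIV. if z \<in> ?Z then v $ z else 0)"
    by (auto simp: matrix_vector_mult_def star_matrix_def intro!: sum.cong)
  also have "\<dots> = (\<Sum>z\<in>?Z. v $ z)"
    by (simp add: sum.If_cases)
  also have "\<dots> = (\<Sum>c\<in>?N. v $ replace_coordinate y i c)"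
  proof -
    have "replace_coordinate y i (z $ i) = z" if "z \<in> ?Z" for z
      using that by (simp add: vec_eq_iff)
    then show ?thesis
      by (intro sum.reindex_bij_witness[of _ "\<lambda>c. replace_coordinate y i c" "\<lambda>z. z $ i"]) auto
  qed
  finally show ?thesis .
qed

lemma coordinate_matrix_apply:
  "(coordinate_matrix x i *v v) $ y = (if y $ i \<noteq> x $ i then v $ y else 0)"
proof -
  have "(coordinate_matrix x i *v v) $ y = (\<Sum>z\<in>UNIV. if z = y then (if y $ i \<noteq> x $ i then v $ y else 0) else 0)"
    unfolding matrix_vector_mult_def coordinate_matrix_def vec_lambda_beta by (rule sum.cong) auto
  then show ?thesis by simp
qed

lemma star_matrix_commute: "star_matrix x i ** star_matrix x j = star_matrix x j ** star_matrix x i"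
proof (cases "i = j")
  case False
  show ?thesis
    unfolding matrix_eq matrix_vector_mul_assoc[symmetric] vec_eq_iff star_matrix_apply
    using False by (auto simp: replace_coordinate_commute[OF False] intro: sum.swap)
qed simp

lemma star_coordinate_commute:
  assumes "i \<noteq> j"
  shows "star_matrix x i ** coordinate_matrix x j = coordinate_matrix x j ** star_matrix x i"
  unfolding matrix_eq matrix_vector_mul_assoc[symmetric] vec_eq_iff star_matrix_apply coordinate_matrix_apply
  using assms by auto

text \<open>The star is bipartite: exactly one end of each edge differs from the centre.\<close>

lemma star_coordinate_anticommute:
  "coordinate_matrix x i ** star_matrix x i + star_matrix x i ** coordinate_matrix x i = star_matrix x i"
  unfolding matrix_eq matrix_vector_mult_add_rdistrib matrix_vector_mul_assoc[symmetric] vec_eq_iff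
  by (auto simp: star_matrix_apply coordinate_matrix_apply intro!: sum.cong)

text \<open>Two steps in the star lead back to the same side of the bipartition. Starting from the centre or
  from a leaf, the number of choices for the intermediate vertex is \<open>n - 1\<close> or \<open>1\<close>; three steps
  meet one factor of each kind.\<close>

lemma star_matrix_cube:
  fixes x :: "'s::finite ^ 'd::finite"
  shows "star_matrix x i ** star_matrix x i ** star_matrix x i = real (CARD('s) - 1) *\<^sub>R star_matrix x i"
proof -
  define N where "N b = card {c. (c = x $ i) \<noteq> b}" for b
  have NN: "real (N b) * real (N (\<not> b)) = real (CARD('s) - 1)" for b
  proof -
    have "{c. c \<noteq> x $ i} = UNIV - {x $ i}" by auto
    then have "N True = CARD('s) - 1" "N False = 1"
      by (simp_all add: N_def card_Diff_subset)
    then show ?thesis by (cases b) auto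
  qed
  have sq: "(star_matrix x i *v (star_matrix x i *v v)) $ y
      = real (N (y $ i = x $ i)) * (\<Sum>c | (c = x $ i) = (y $ i = x $ i). v $ replace_coordinate y i c)" for v y
  proof -
    have "(star_matrix x i *v (star_matrix x i *v v)) $ y
      = (\<Sum>c | (c = x $ i) \<noteq> (y $ i = x $ i).
          \<Sum>c' | (c' = x $ i) = (y $ i = x $ i). v $ replace_coordinate y i c')"
      unfolding star_matrix_apply by (rule sum.cong) (auto intro!: sum.cong)
    then show ?thesis by (simp add: N_def)
  qed
  have "(star_matrix x i *v (star_matrix x i *v (star_matrix x i *v v))) $ y
      = real (CARD('s) - 1) * (star_matrix x i *v v) $ y" for v y
  proof -
    have "(star_matrix x i *v (star_matrix x i *v (star_matrix x i *v v))) $ y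
      = real (N (y $ i = x $ i)) * (\<Sum>c | (c = x $ i) = (y $ i = x $ i).
          (\<Sum>c' | (c' = x $ i) \<noteq> (y $ i = x $ i). v $ replace_coordinate y i c'))"
      unfolding sq[of "star_matrix x i *v v" y]
      by (intro arg_cong2[of _ _ _ _ "(*)"] refl sum.cong) (auto simp: star_matrix_apply)
    also have "\<dots> = real (N (y $ i = x $ i)) * real (N (\<not> (y $ i = x $ i))) * (star_matrix x i *v v) $ y"
      by (simp add: star_matrix_apply N_def)
    finally show ?thesis by (simp add: NN)
  qed
  then show ?thesis
    by (simp add: matrix_eq vec_eq_iff matrix_vector_mul_assoc[symmetric]
        scaleR_matrix_vector_assoc[symmetric])
qed

lemma commutator_sum:
  fixes S X :: "'i \<Rightarrow> real ^ 'v::finite ^ 'v"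
  assumes "finite I" and "\<And>i j. i \<noteq> j \<Longrightarrow> S i ** X j = X j ** S i"
  shows "commutator (\<Sum>i\<in>I. S i) (\<Sum>j\<in>I. X j) = (\<Sum>i\<in>I. commutator (S i) (X i))"
proof -
  have "commutator (\<Sum>i\<in>I. S i) (\<Sum>j\<in>I. X j) = (\<Sum>i\<in>I. \<Sum>j\<in>I. commutator (S i) (X j))"
    unfolding commutator_def matrix_mult_sum_left matrix_mult_sum_right sum_subtractf
    by (rule arg_cong[OF sum.swap])
  also have "\<dots> = (\<Sum>i\<in>I. \<Sum>j\<in>I. if i = j then commutator (S i) (X i) else 0)"
    using assms(2) by (intro sum.cong refl) (auto simp: commutator_def)
  finally show ?thesis using assms(1) by simp
qed

text \<open>Write \<open>C = [S, a] = S(2a - 1)\<close>. The relation \<open>aS + Sa = S\<close> gives \<open>CS = -SC\<close>, so each further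
  commutator with \<open>S\<close> is multiplication by \<open>2S\<close>, and \<open>4 S\<^sup>2 C = 4k C\<close>. The proof expands this
  in terms of words with \<open>a\<close> on the right.\<close>

lemma commutator_cubic_star:
  fixes S a :: "real ^ 'v::finite ^ 'v"
  assumes cube: "S ** S ** S = k *\<^sub>R S" and anti: "a ** S + S ** a = S"
  shows "commutator S (commutator S (commutator S a)) = (4 * k) *\<^sub>R commutator S a"
proof -
  have aS: "a ** S = S - S ** a"
    using anti by (simp add: eq_diff_eq)
  have SaS: "S ** a ** S = S ** S - S ** S ** a"
    by (simp add: matrix_mul_assoc[symmetric] aS matrix_mult_diff_right)
  have c1: "commutator S a = 2 *\<^sub>R (S ** a) - S"
    by (simp add: commutator_def aS vec_eq_iff)
  have c2: "commutator S (commutator S a) = 4 *\<^sub>R (S ** S ** a) - 2 *\<^sub>R (S ** S)"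
    unfolding c1 commutator_def[of S "_ - _"]
    by (simp add: matrix_mult_diff_left matrix_mult_diff_right matrix_mult_scaleR_left
        matrix_mult_scaleR_right matrix_mul_assoc SaS) (simp add: vec_eq_iff)
  have SSaS: "S ** S ** a ** S = S ** S ** S - S ** S ** S ** a"
    by (metis SaS matrix_mul_assoc matrix_mult_diff_right)
  have "commutator S (commutator S (commutator S a)) = 8 *\<^sub>R (S ** S ** S ** a) - 4 *\<^sub>R (S ** S ** S)"
    unfolding c2 commutator_def[of S "_ - _"]
    by (simp add: matrix_mult_diff_left matrix_mult_diff_right matrix_mult_scaleR_left
        matrix_mult_scaleR_right matrix_mul_assoc SSaS) (simp add: vec_eq_iff)
  then show ?thesis
    unfolding cube c1 by (simp add: matrix_mult_scaleR_left scaleR_diff_right)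
qed

text \<open>Mixed commutators vanish, also after taking commutators repeatedly, so a linear relation between
  iterated commutators can be checked coordinatewise.\<close>

lemma commutator_cubic_sum:
  fixes S a :: "'i \<Rightarrow> real ^ 'v::finite ^ 'v"
  assumes "finite I"
    and SS: "\<And>i j. S i ** S j = S j ** S i"
    and Sa: "\<And>i j. i \<noteq> j \<Longrightarrow> S i ** a j = a j ** S i"
    and cubic: "\<And>i. commutator (S i) (commutator (S i) (commutator (S i) (a i))) = k *\<^sub>R commutator (S i) (a i)"
  shows "commutator (\<Sum>i\<in>I. S i) (commutator (\<Sum>i\<in>I. S i) (commutator (\<Sum>i\<in>I. S i) (\<Sum>i\<in>I. a i)))
      = k *\<^sub>R commutator (\<Sum>i\<in>I. S i) (\<Sum>i\<in>I. a i)"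
proof -
  have step: "S i ** commutator (S j) X = commutator (S j) X ** S i" if "S i ** X = X ** S i" for i j X
  proof -
    have "S i ** (S j ** X) = S j ** X ** S i"
      by (metis SS that matrix_mul_assoc)
    moreover have "S i ** (X ** S j) = X ** S j ** S i"
      by (metis SS that matrix_mul_assoc)
    ultimately show ?thesis
      by (simp add: commutator_def matrix_mult_diff_left matrix_mult_diff_right)
  qed
  have c1: "commutator (\<Sum>i\<in>I. S i) (\<Sum>i\<in>I. a i) = (\<Sum>i\<in>I. commutator (S i) (a i))"
    by (rule commutator_sum[OF assms(1) Sa])
  have c2: "commutator (\<Sum>i\<in>I. S i) (\<Sum>i\<in>I. commutator (S i) (a i))
      = (\<Sum>i\<in>I. commutator (S i) (commutator (S i) (a i)))"
    by (rule commutator_sum[OF assms(1) step[OF Sa]])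
  have c3: "commutator (\<Sum>i\<in>I. S i) (\<Sum>i\<in>I. commutator (S i) (commutator (S i) (a i)))
      = (\<Sum>i\<in>I. commutator (S i) (commutator (S i) (commutator (S i) (a i))))"
    by (rule commutator_sum[OF assms(1) step[OF step[OF Sa]]])
  show ?thesis
    unfolding c1 c2 c3 cubic scaleR_sum_right ..
qed

section \<open>The full bipartite graph of the Hamming graph\<close>

definition hamming_distance :: "'s ^ 'd \<Rightarrow> 's ^ 'd \<Rightarrow> nat" where
  "hamming_distance y z = card {i. y $ i \<noteq> z $ i}"

definition star_graph :: "'s ^ 'd \<Rightarrow> (('s ^ 'd) \<times> ('s ^ 'd)) set" where
  "star_graph x = {(y, z). \<exists>i. (\<forall>j. j \<noteq> i \<longrightarrow> y $ j = z $ j) \<and> (y $ i = x $ i) \<noteq> (z $ i = x $ i)}"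

lemma hamming_distance_le_walk:
  fixes y z :: "'s ^ 'd::finite"
  shows "(y, z) \<in> hamming_graph ^^ k \<Longrightarrow> hamming_distance y z \<le> k"
proof (induction k arbitrary: z)
  case 0
  then show ?case by (simp add: hamming_distance_def)
next
  case (Suc k)
  then obtain w where w: "(y, w) \<in> hamming_graph ^^ k" "(w, z) \<in> hamming_graph" by auto
  have "{i. y $ i \<noteq> z $ i} \<subseteq> {i. y $ i \<noteq> w $ i} \<union> {i. w $ i \<noteq> z $ i}" by auto
  then have "hamming_distance y z \<le> card ({i. y $ i \<noteq> w $ i} \<union> {i. w $ i \<noteq> z $ i})"
    unfolding hamming_distance_def by (intro card_mono) auto
  also have "\<dots> \<le> hamming_distance y w + 1"
    using card_Un_le[of "{i. y $ i \<noteq> w $ i}" "{i. w $ i \<noteq> z $ i}"] w(2)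
    by (simp add: hamming_distance_def hamming_graph_def)
  finally show ?case using Suc.IH[OF w(1)] by simp
qed

lemma star_walk:
  fixes x y :: "'s ^ 'd::finite"
  shows "(x, y) \<in> star_graph x ^^ hamming_distance x y"
proof (induction "hamming_distance x y" arbitrary: y)
  case 0
  then show ?case by (simp add: hamming_distance_def vec_eq_iff)
next
  case (Suc k)
  then obtain i where i: "x $ i \<noteq> y $ i"
    by (metis (mono_tags, lifting) card_eq_0_iff empty_Collect_eq hamming_distance_def nat.distinct(1))
  have "{j. x $ j \<noteq> replace_coordinate y i (x $ i) $ j} = {j. x $ j \<noteq> y $ j} - {i}" by auto
  then have "hamming_distance x (replace_coordinate y i (x $ i)) = k"
    using Suc.hyps(2) i by (simp add: hamming_distance_def)
  then have "(x, replace_coordinate y i (x $ i)) \<in> star_graph x ^^ k" using Suc.hyps(1) by blast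
  moreover have "(replace_coordinate y i (x $ i), y) \<in> star_graph x"
    using i by (auto simp: star_graph_def intro!: exI[of _ i])
  ultimately show ?case unfolding Suc.hyps(2)[symmetric] by auto
qed

lemma relpow_subset_mono:
  fixes R S :: "('a \<times> 'a) set"
  shows "R \<subseteq> S \<Longrightarrow> R ^^ k \<subseteq> S ^^ k"
  by (induction k) (simp_all add: relcomp_mono)

text \<open>The Hamming distance is a lower bound for walks in any subgraph of the Hamming graph, and a walk
  from \<open>x\<close> to \<open>y\<close> that changes one coordinate at a time to its value in \<open>y\<close> uses edges of the
  star graph only. The formula applies both to the Hamming graph and to its full bipartite graph.\<close>

lemma graph_dist_hamming:
  fixes x y :: "'s ^ 'd::finite"
  assumes "star_graph x \<subseteq> G" and "G \<subseteq> hamming_graph"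
  shows "graph_dist G x y = hamming_distance x y"
  unfolding graph_dist_def
proof (rule Least_equality)
  show "(x, y) \<in> G ^^ hamming_distance x y"
    by (rule subsetD[OF relpow_subset_mono[OF assms(1)] star_walk])
  show "hamming_distance x y \<le> k" if "(x, y) \<in> G ^^ k" for k
    by (rule hamming_distance_le_walk[OF subsetD[OF relpow_subset_mono[OF assms(2)] that]])
qed

lemma hamming_graph_iff:
  "(y, z) \<in> hamming_graph \<longleftrightarrow> (\<exists>i. y $ i \<noteq> z $ i \<and> (\<forall>j. j \<noteq> i \<longrightarrow> y $ j = z $ j))"
proof -
  have "(y, z) \<in> hamming_graph \<longleftrightarrow> (\<exists>i. {j. y $ j \<noteq> z $ j} = {i})"
    by (simp add: hamming_graph_def card_1_singleton_iff)
  then show ?thesis by auto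
qed

lemma star_graph_subset_hamming: "star_graph x \<subseteq> hamming_graph"
proof (clarify)
  fix y z assume "(y, z) \<in> star_graph x"
  then obtain i where "\<forall>j. j \<noteq> i \<longrightarrow> y $ j = z $ j" "(y $ i = x $ i) \<noteq> (z $ i = x $ i)"
    by (auto simp: star_graph_def)
  then show "(y, z) \<in> hamming_graph"
    unfolding hamming_graph_iff by (intro exI[of _ i]) auto
qed

lemma hamming_distance_eq_sum:
  fixes x y :: "'s ^ 'd::finite"
  shows "hamming_distance x y = (\<Sum>i\<in>UNIV. of_bool (x $ i \<noteq> y $ i))"
  by (simp add: hamming_distance_def)

text \<open>If \<open>y\<close> and \<open>z\<close> differ only in coordinate \<open>i\<close>, then only this coordinate can make their distances
  from \<open>x\<close> different, and it does so iff exactly one of \<open>y $ i\<close>, \<open>z $ i\<close> equals \<open>x $ i\<close>.\<close>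

lemma full_bipartite_hamming_graph:
  fixes x :: "'s ^ 'd::finite"
  shows "full_bipartite_graph hamming_graph x = star_graph x"
proof -
  have dist: "graph_dist hamming_graph x y = hamming_distance x y" for y
    by (rule graph_dist_hamming[OF star_graph_subset_hamming order_refl])
  have key: "hamming_distance x y = hamming_distance x z \<longleftrightarrow> (y $ i = x $ i) = (z $ i = x $ i)"
    if "\<forall>j. j \<noteq> i \<longrightarrow> y $ j = z $ j" for y z i
  proof -
    have split: "hamming_distance x w =
        of_bool (x $ i \<noteq> w $ i) + (\<Sum>j\<in>UNIV - {i}. of_bool (x $ j \<noteq> w $ j))" for w
      unfolding hamming_distance_eq_sum by (rule sum.remove) auto
    have "(\<Sum>j\<in>UNIV - {i}. of_bool (x $ j \<noteq> y $ j)) = (\<Sum>j\<in>UNIV - {i}. of_bool (x $ j \<noteq> z $ j) :: nat)"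
      using that by (intro sum.cong) auto
    then show ?thesis unfolding split by auto
  qed
  show ?thesis
  proof (rule set_eqI, clarify)
    fix y z
    have "(y, z) \<in> full_bipartite_graph hamming_graph x \<longleftrightarrow>
        (\<exists>i. (y $ i \<noteq> z $ i \<and> (\<forall>j. j \<noteq> i \<longrightarrow> y $ j = z $ j)) \<and> hamming_distance x y \<noteq> hamming_distance x z)"
      by (simp add: full_bipartite_graph_def dist hamming_graph_iff) blast
    also have "\<dots> \<longleftrightarrow> (\<exists>i. (\<forall>j. j \<noteq> i \<longrightarrow> y $ j = z $ j) \<and> (y $ i = x $ i) \<noteq> (z $ i = x $ i))"
      by (rule arg_cong[of _ _ Ex], rule ext) (use key in auto)
    finally show "(y, z) \<in> full_bipartite_graph hamming_graph x \<longleftrightarrow> (y, z) \<in> star_graph x"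
      by (simp add: star_graph_def)
  qed
qed

lemma adjacency_matrix_star_graph:
  "adjacency_matrix (star_graph x) = (\<Sum>i\<in>UNIV. star_matrix x i)"
proof -
  have "adjacency_matrix (star_graph x) $ y $ z = (\<Sum>i\<in>UNIV. star_matrix x i $ y $ z)" for y z
  proof -
    let ?P = "\<lambda>i. (\<forall>j. j \<noteq> i \<longrightarrow> y $ j = z $ j) \<and> (y $ i = x $ i) \<noteq> (z $ i = x $ i)"
    show ?thesis
    proof (cases "\<exists>i. ?P i")
      case True
      then obtain i where i: "?P i" by blast
      then have "?P j \<longleftrightarrow> j = i" for j by auto
      then have "(\<Sum>j\<in>UNIV. star_matrix x j $ y $ z) = (\<Sum>j\<in>UNIV. if j = i then 1 else 0)"
        by (simp add: star_matrix_def)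
      then show ?thesis using True by (simp add: adjacency_matrix_def star_graph_def)
    next
      case False
      then have "star_matrix x i $ y $ z = 0" for i by (simp add: star_matrix_def)
      then show ?thesis using False by (simp add: adjacency_matrix_def star_graph_def)
    qed
  qed
  then show ?thesis by (simp add: vec_eq_iff)
qed

section \<open>The dual adjacency matrix\<close>

definition distance_matrix :: "('v::finite \<times> 'v) set \<Rightarrow> 'v \<Rightarrow> real ^ 'v ^ 'v" where
  "distance_matrix G x = (\<chi> y z. if y = z then real (graph_dist G x y) else 0)"

text \<open>The standard basis vectors are eigenvectors of the distance matrix, and the primitive idempotent
  for the eigenvalue \<open>k\<close> is \<open>E\<^sup>*\<^sub>k\<close>.\<close>

lemma generated_subalgebra_distance_matrix:
  "generated_subalgebra (distance_matrix G x) = dual_adjacency_algebra G x"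
proof -
  let ?\<Theta> = "real ` {0..eccentricity G x}"
  define E where "E \<theta> = dual_idempotent G x (nat \<lfloor>\<theta>\<rfloor>)" for \<theta> :: real
  have B: "(distance_matrix G x *v v) $ y = real (graph_dist G x y) * v $ y" for v y
  proof -
    have "(distance_matrix G x *v v) $ y = (\<Sum>z\<in>UNIV. if z = y then real (graph_dist G x y) * v $ y else 0)"
      unfolding matrix_vector_mult_def distance_matrix_def vec_lambda_beta by (rule sum.cong) auto
    then show ?thesis by simp
  qed
  have Estar: "(dual_idempotent G x i *v v) $ y = (if graph_dist G x y = i then v $ y else 0)" for v y i
  proof -
    have "(dual_idempotent G x i *v v) $ y = (\<Sum>z\<in>UNIV. if z = y then (if graph_dist G x y = i then v $ y else 0) else 0)"
      unfolding matrix_vector_mult_def dual_idempotent_def vec_lambda_beta by (rule sum.cong) auto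
    then show ?thesis by simp
  qed
  have eigen: "v \<in> eigenspace (distance_matrix G x) (real k) \<longleftrightarrow> (\<forall>y. graph_dist G x y \<noteq> k \<longrightarrow> v $ y = 0)" for v k
    by (auto simp: eigenspace_def vec_eq_iff B)
  have "span (\<Union>\<theta>\<in>?\<Theta>. eigenspace (distance_matrix G x) \<theta>) = UNIV"
  proof -
    have "v \<in> span (\<Union>\<theta>\<in>?\<Theta>. eigenspace (distance_matrix G x) \<theta>)" for v
    proof -
      have le: "graph_dist G x y \<le> eccentricity G x" for y
        by (simp add: eccentricity_def)
      have "v = (\<Sum>k\<in>{0..eccentricity G x}. dual_idempotent G x k *v v)"
        using le by (simp add: vec_eq_iff Estar)
      also have "\<dots> \<in> span (\<Union>\<theta>\<in>?\<Theta>. eigenspace (distance_matrix G x) \<theta>)"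
        by (intro span_sum span_base) (auto simp: eigen Estar)
      finally show ?thesis .
    qed
    then show ?thesis by auto
  qed
  then have "spectral_decomposition (distance_matrix G x) ?\<Theta> E"
    unfolding spectral_decomposition_def
    by (auto simp: eigen E_def vec_eq_iff Estar)
  then have "generated_subalgebra (distance_matrix G x) = span (E ` ?\<Theta>)"
    by (rule generated_subalgebra_spectral)
  also have "E ` ?\<Theta> = dual_idempotent G x ` {0..eccentricity G x}"
    by (simp add: image_image E_def)
  finally show ?thesis by (simp add: dual_adjacency_algebra_def)
qed

lemma distance_matrix_star_graph:
  "distance_matrix (star_graph x) x = (\<Sum>i\<in>UNIV. coordinate_matrix x i)"
proof -
  have "real (hamming_distance x y) = (\<Sum>i\<in>UNIV. if y $ i \<noteq> x $ i then 1 else 0)" for y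
    unfolding hamming_distance_eq_sum of_nat_sum by (rule sum.cong) auto
  then have "distance_matrix (star_graph x) x $ y $ z = (\<Sum>i\<in>UNIV. coordinate_matrix x i $ y $ z)" for y z
    by (cases "y = z")
      (simp_all add: distance_matrix_def coordinate_matrix_def
        graph_dist_hamming[OF order_refl star_graph_subset_hamming])
  then show ?thesis by (simp add: vec_eq_iff)
qed

section \<open>The Q-polynomial property of the full bipartite Hamming graph\<close>

theorem corollary7p4:
  fixes x :: "'s::finite ^ 'd::finite"
    and \<Gamma> :: "(('s ^ 'd) \<times> ('s ^ 'd)) set"
    and A :: "real ^ ('s ^ 'd) ^ ('s ^ 'd)"
  assumes "CARD('d) \<ge> 3" and "CARD('s) \<ge> 3"
    and "\<Gamma> = full_bipartite_graph hamming_graph x"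
    and "A = adjacency_matrix \<Gamma>"
  shows "Q_polynomial \<Gamma> x A"
proof -
  define s where "s = sqrt (real (CARD('s) - 1))"
  have s: "s > 0" "s\<^sup>2 = real (CARD('s) - 1)"
    using assms(2) by (simp_all add: s_def)
  have \<Gamma>: "\<Gamma> = star_graph x"
    using assms(3) by (simp add: full_bipartite_hamming_graph)
  have A: "A = (\<Sum>i\<in>UNIV. star_matrix x i)"
    using assms(4) by (simp add: \<Gamma> adjacency_matrix_star_graph)
  have cube: "star_matrix x i ** star_matrix x i ** star_matrix x i = s\<^sup>2 *\<^sub>R star_matrix x i" for i
    by (simp add: star_matrix_cube s(2))
  have "diagonalisable A"
    unfolding A using s(1)
    by (intro diagonalisable_sum diagonalisable_cube[OF cube] star_matrix_commute) auto
  moreover have "generated_subalgebra (distance_matrix \<Gamma> x) = dual_adjacency_algebra \<Gamma> x"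
    by (rule generated_subalgebra_distance_matrix)
  moreover have "commutator A (commutator A (commutator A (distance_matrix \<Gamma> x)))
      = (2 * s)\<^sup>2 *\<^sub>R commutator A (distance_matrix \<Gamma> x)"
  proof -
    have "(2 * s)\<^sup>2 = 4 * s\<^sup>2" by (simp add: power_mult_distrib)
    then show ?thesis
      unfolding A \<Gamma> distance_matrix_star_graph
      by (intro commutator_cubic_sum star_matrix_commute star_coordinate_commute)
        (simp_all add: commutator_cubic_star[OF cube star_coordinate_anticommute])
  qed
  ultimately show ?thesis
    using s(1) by (intro Q_polynomial_if_cubic[where c = "2 * s"]) auto
qed

end
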